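(* Suppose that for every initial state $s_0=\xi\sim\mu$, $\sup_{\pi\in\Pi}\mathbb{E}^{\pi}\big[\sum_{t=0}^\infty\gamma^t|r(s_t,\mu_t,a_t,\nu_t)|\big]<\infty$. Then for any $\mu\in\mathcal{P}(\mathcal{S})$ and $h\in\mathcal{H}$, the IQ function $Q$ satisfies $$Q(\mu,h)=\widehat r(\mu,h)+\gamma\sup_{h'\in\mathcal{H}}Q(\Phi(\mu,h),h').$$
   Context: Setting (mean-field control, MFC). $(\mathcal{S},d_{\mathcal{S}})$ and $(\mathcal{A},d_{\mathcal{A}})$ are compact separable metric spaces (state and action spaces); for such a space $X$, $\mathcal{P}(X)$ is the set of Borel probability measures on $X$ with the topology of weak convergence, metrized by the Wasserstein-1 distance, and its Borel $\sigma$-field. $\gamma\in(0,1)$ is a discount factor. $P:\mathcal{S}\times\mathcal{P}(\mathcal{S})\times\mathcal{A}\times\mathcal{P}(\mathcal{A})\to\mathcal{P}(\mathcal{S})$ (transition) and $R:\mathcal{S}\times\mathcal{P}(\mathcal{S})\times\mathcal{A}\times\mathcal{P}(\mathcal{A})\to\mathcal{P}(\mathbb{R})$ (reward law) are measurable. The underlying probability space $(\Omega,\mathcal{F},\mathbb{P})$ is Polish and atomless, rich enough that every $\mu\in\mathcal{P}(\mathcal{S})$ is the law of some $\mathcal{S}$-valued random variable. An admissible control $\pi=\{\pi_t\}_{t\ge 0}$ is a sequence of measurable maps $\pi_t:\mathcal{S}\times\mathcal{P}(\mathcal{S})\to\mathcal{P}(\mathcal{A})$ (relaxed feedback controls); $\Pi$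 is the set of such sequences, and $\Pi_1$ is the set of such sequences $\{\pi_t\}_{t\ge1}$ starting from time $1$. Given $\pi$ and an initial state $s_0=\xi\sim\mu$, the dynamics are $$a_t\sim\pi_t(s_t,\mu_t),\quad s_{t+1}\sim P(s_t,\mu_t,a_t,\nu_t),\quad r(s_t,\mu_t,a_t,\nu_t)\sim R(s_t,\mu_t,a_t,\nu_t),$$ where $\mu_t$ is the law of $s_t$ and $\nu_t$ is the law of $a_t$, so $\nu_t(\cdot)=\int_{\mathcal{S}}\pi_t(s,\mu_t)(\cdot)\,\mu_t(ds)$. $\mathbb{E}^\pi$ is expectation under control $\pi$. $\mathcal{H}$ is the set of measurable maps $h:\mathcal{S}\to\mathcal{P}(\mathcal{A})$ (local policies) for which the integrability assumption stated in the claim holds. A control $\pi_t$ is also viewed as a measurable map $\mathcal{P}(\mathcal{S})\to\mathcal{H}$, $\pi_t(\mu)(s)=\pi_t(s,\mu)$. For $(\mu,h)\in\mathcal{P}(\mathcal{S})\times\mathcal{H}$ define $\nu(\mu,h)(\cdot)=\int_{\mathcal{S}}h(s)(\cdot)\,\mu(ds)\in\mathcal{P}(\mathcal{A})$, $$\Phi(\mu,h)(ds')=\int_{\mathcal{S}}\mu(ds)\int_{\mathcal{A}}h(s)(da)\,P(s,\mu,a,\nu(\mu,h))(ds'),$$ $$\widehat r(\mu,h)=\int_{\mathcal{S}}\mu(ds)\int_{\mathcal{A}}h(s)(da)\int_{\mathbb{R}}r\,R(s,\mu,a,\nu(\mu,h))(dr).$$ IQ function: for $\mu\in\mathcal{P}(\mathcal{S})$,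 $h\in\mathcal{H}$, $Q(\mu,h)=\sup_{\pi\in\Pi_1}Q^\pi(\mu,h)$, where $$Q^\pi(\mu,h)=\mathbb{E}^\pi\Big[\sum_{t=0}^\infty\gamma^t r(s_t,\mu_t,a_t,\nu_t)\,\Big|\,s_0\sim\mu,\ a_0\sim h(s_0),\ a_t\sim\pi_t(s_t,\mu_t)\text{ for }t\ge1\Big].$$ *)

theory Defs
  imports "HOL-Probability.Probability"
begin

section \<open>Borel probability measures with the weak topology\<close>

definition prob_measures :: "'x::topological_space measure set" where
  "prob_measures = {M. prob_space M \<and> sets M = sets borel}"

text \<open>The topology of weak convergence: the coarsest topology on the set of Borel probability
  measures for which integration of every bounded continuous function is continuous.
  On a compact metric space it is the topology of the Wasserstein-1 distance.\<close>

definition weak_topology :: "'x::topological_space measure topology" where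
  "weak_topology = topology_generated_by
     {{M \<in> prob_measures. (\<integral>x. f x \<partial>M) \<in> U} | f U.
        continuous_on UNIV f \<and> bounded (range f) \<and> open (U :: real set)}"

definition weak_borel :: "'x::topological_space measure measure" where
  "weak_borel = sigma prob_measures {U. openin weak_topology U}"

definition atomless :: "'w measure \<Rightarrow> bool" where
  "atomless M \<longleftrightarrow> (\<forall>A\<in>sets M. 0 < emeasure M A \<longrightarrow>
     (\<exists>B\<in>sets M. B \<subseteq> A \<and> 0 < emeasure M B \<and> emeasure M B < emeasure M A))"


section \<open>Mean-field control\<close>

type_synonym ('s, 'a, 'y) mf_kernel = "'s \<Rightarrow> 's measure \<Rightarrow> 'a \<Rightarrow> 'a measure \<Rightarrow> 'y measure"
type_synonym ('s, 'a) policy = "'s \<Rightarrow> 'a measure"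
type_synonym ('s, 'a) control = "nat \<Rightarrow> 's \<Rightarrow> 's measure \<Rightarrow> 'a measure"

definition measurable_kernel ::
  "('s::topological_space, 'a::topological_space, 'y::topological_space) mf_kernel \<Rightarrow> bool" where
  "measurable_kernel K \<longleftrightarrow>
     (\<lambda>(s, \<mu>, a, \<nu>). K s \<mu> a \<nu>)
       \<in> borel \<Otimes>\<^sub>M weak_borel \<Otimes>\<^sub>M borel \<Otimes>\<^sub>M weak_borel \<rightarrow>\<^sub>M weak_borel"

text \<open>\<open>controls_from k\<close> is the set of control sequences starting from time \<open>k\<close>;
  the entries before time \<open>k\<close> are unconstrained and never used.
  Thus \<open>\<Pi>\<close> is \<open>controls_from 0\<close> and \<open>\<Pi>\<^sub>1\<close> is \<open>controls_from 1\<close>.\<close>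

definition controls_from :: "nat \<Rightarrow> ('s::topological_space, 'a::topological_space) control set" where
  "controls_from k = {\<pi>. \<forall>t\<ge>k. (\<lambda>(s, \<mu>). \<pi> t s \<mu>) \<in> borel \<Otimes>\<^sub>M weak_borel \<rightarrow>\<^sub>M weak_borel}"

definition mean_action ::
  "'s::topological_space measure \<Rightarrow> ('s, 'a::topological_space) policy \<Rightarrow> 'a measure" where
  "mean_action \<mu> h = \<mu> \<bind> h"

definition Phi :: "('s::topological_space, 'a::topological_space, 's) mf_kernel \<Rightarrow>
    's measure \<Rightarrow> ('s, 'a) policy \<Rightarrow> 's measure" where
  "Phi P \<mu> h = \<mu> \<bind> (\<lambda>s. h s \<bind> (\<lambda>a. P s \<mu> a (mean_action \<mu> h)))"

definition rhat :: "('s::topological_space, 'a::topological_space, real) mf_kernel \<Rightarrow>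
    's measure \<Rightarrow> ('s, 'a) policy \<Rightarrow> real" where
  "rhat R \<mu> h = (\<integral>s. (\<integral>a. (\<integral>r. r \<partial>R s \<mu> a (mean_action \<mu> h)) \<partial>h s) \<partial>\<mu>)"


subsection \<open>The controlled process\<close>

text \<open>The law of the process is built on the canonical space of sequences of triples
  \<open>(s\<^sub>t, a\<^sub>t, r\<^sub>t)\<close> by the theorem of Ionescu Tulcea. The transition kernels need the laws of
  \<open>s\<^sub>t\<close> and \<open>a\<^sub>t\<close>, which are deterministic and are given recursively by \<open>state_law\<close> and
  \<open>action_law\<close>; that these are indeed the laws of \<open>s\<^sub>t\<close> and \<open>a\<^sub>t\<close> under the measure constructed from
  them is shown in \<open>distr_state_trajectory_law\<close> and \<open>distr_action_trajectory_law\<close> below.\<close>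

primrec state_law :: "('s::topological_space, 'a::topological_space, 's) mf_kernel \<Rightarrow>
    ('s, 'a) control \<Rightarrow> 's measure \<Rightarrow> nat \<Rightarrow> 's measure" where
  "state_law P \<pi> \<mu> 0 = \<mu>"
| "state_law P \<pi> \<mu> (Suc t) = Phi P (state_law P \<pi> \<mu> t) (\<lambda>s. \<pi> t s (state_law P \<pi> \<mu> t))"

definition action_law :: "('s::topological_space, 'a::topological_space, 's) mf_kernel \<Rightarrow>
    ('s, 'a) control \<Rightarrow> 's measure \<Rightarrow> nat \<Rightarrow> 'a measure" where
  "action_law P \<pi> \<mu> t = mean_action (state_law P \<pi> \<mu> t) (\<lambda>s. \<pi> t s (state_law P \<pi> \<mu> t))"

abbreviation step_space :: "('s::topological_space \<times> 'a::topological_space \<times> real) measure" where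
  "step_space \<equiv> borel \<Otimes>\<^sub>M borel \<Otimes>\<^sub>M borel"

text \<open>Conditional law of \<open>(s\<^sub>t, a\<^sub>t, r\<^sub>t)\<close> given \<open>s\<^sub>t = s\<close>.\<close>

definition act_kernel :: "('s::topological_space, 'a::topological_space, 's) mf_kernel \<Rightarrow>
    ('s, 'a, real) mf_kernel \<Rightarrow> ('s, 'a) control \<Rightarrow> 's measure \<Rightarrow> nat \<Rightarrow>
    's \<Rightarrow> ('s \<times> 'a \<times> real) measure" where
  "act_kernel P R \<pi> \<mu> t s =
     \<pi> t s (state_law P \<pi> \<mu> t) \<bind> (\<lambda>a.
     R s (state_law P \<pi> \<mu> t) a (action_law P \<pi> \<mu> t) \<bind> (\<lambda>r.
     return step_space (s, a, r)))"

text \<open>Conditional law of \<open>(s\<^sub>t, a\<^sub>t, r\<^sub>t)\<close> given the history \<open>\<omega>\<close> up to time \<open>t - 1\<close>.\<close>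

fun step_kernel :: "('s::topological_space, 'a::topological_space, 's) mf_kernel \<Rightarrow>
    ('s, 'a, real) mf_kernel \<Rightarrow> ('s, 'a) control \<Rightarrow> 's measure \<Rightarrow> nat \<Rightarrow>
    (nat \<Rightarrow> 's \<times> 'a \<times> real) \<Rightarrow> ('s \<times> 'a \<times> real) measure" where
  "step_kernel P R \<pi> \<mu> 0 \<omega> = \<mu> \<bind> act_kernel P R \<pi> \<mu> 0"
| "step_kernel P R \<pi> \<mu> (Suc t) \<omega> =
     (case \<omega> t of (s, a, r) \<Rightarrow>
        P s (state_law P \<pi> \<mu> t) a (action_law P \<pi> \<mu> t) \<bind> act_kernel P R \<pi> \<mu> (Suc t))"

definition trajectory_law :: "('s::topological_space, 'a::topological_space, 's) mf_kernel \<Rightarrow>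
    ('s, 'a, real) mf_kernel \<Rightarrow> ('s, 'a) control \<Rightarrow> 's measure \<Rightarrow>
    (nat \<Rightarrow> 's \<times> 'a \<times> real) measure" where
  "trajectory_law P R \<pi> \<mu> = projective_family.lim UNIV
     (Ionescu_Tulcea.CI (step_kernel P R \<pi> \<mu>) (\<lambda>_. step_space)) (\<lambda>_. step_space)"

definition reward :: "nat \<Rightarrow> (nat \<Rightarrow> 's \<times> 'a \<times> real) \<Rightarrow> real" where
  "reward t \<omega> = snd (snd (\<omega> t))"

definition expected_return :: "('s::topological_space, 'a::topological_space, 's) mf_kernel \<Rightarrow>
    ('s, 'a, real) mf_kernel \<Rightarrow> real \<Rightarrow> ('s, 'a) control \<Rightarrow> 's measure \<Rightarrow> real" where
  "expected_return P R \<gamma> \<pi> \<mu> = (\<integral>\<omega>. (\<Sum>t. \<gamma> ^ t * reward t \<omega>) \<partial>trajectory_law P R \<pi> \<mu>)"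

definition expected_abs_return :: "('s::topological_space, 'a::topological_space, 's) mf_kernel \<Rightarrow>
    ('s, 'a, real) mf_kernel \<Rightarrow> real \<Rightarrow> ('s, 'a) control \<Rightarrow> 's measure \<Rightarrow> ennreal" where
  "expected_abs_return P R \<gamma> \<pi> \<mu> =
     (\<integral>\<^sup>+\<omega>. (\<Sum>t. ennreal (\<gamma> ^ t * \<bar>reward t \<omega>\<bar>)) \<partial>trajectory_law P R \<pi> \<mu>)"


subsection \<open>Local policies and the IQ function\<close>

text \<open>The control which uses the local policy \<open>h\<close> at time 0 and follows \<open>\<pi>\<close> from time 1 on.\<close>

definition first_policy :: "('s, 'a) policy \<Rightarrow> ('s, 'a) control \<Rightarrow> ('s, 'a) control" where
  "first_policy h \<pi> = \<pi>(0 := (\<lambda>s \<mu>. h s))"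

definition local_policies :: "('s::topological_space, 'a::topological_space, 's) mf_kernel \<Rightarrow>
    ('s, 'a, real) mf_kernel \<Rightarrow> real \<Rightarrow> ('s, 'a) policy set" where
  "local_policies P R \<gamma> = {h. h \<in> borel \<rightarrow>\<^sub>M weak_borel \<and>
     (\<forall>\<mu>\<in>prob_measures.
        (SUP \<pi>\<in>controls_from 1. expected_abs_return P R \<gamma> (first_policy h \<pi>) \<mu>) < \<infinity>)}"

definition IQ_policy :: "('s::topological_space, 'a::topological_space, 's) mf_kernel \<Rightarrow>
    ('s, 'a, real) mf_kernel \<Rightarrow> real \<Rightarrow> ('s, 'a) control \<Rightarrow> 's measure \<Rightarrow> ('s, 'a) policy \<Rightarrow> real"
  where
  "IQ_policy P R \<gamma> \<pi> \<mu> h = expected_return P R \<gamma> (first_policy h \<pi>) \<mu>"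

text \<open>The supremum is taken in the extended reals, so that it is meaningful without a prior
  boundedness argument.\<close>

definition IQ :: "('s::topological_space, 'a::topological_space, 's) mf_kernel \<Rightarrow>
    ('s, 'a, real) mf_kernel \<Rightarrow> real \<Rightarrow> 's measure \<Rightarrow> ('s, 'a) policy \<Rightarrow> ereal" where
  "IQ P R \<gamma> \<mu> h = (SUP \<pi>\<in>controls_from 1. ereal (IQ_policy P R \<gamma> \<pi> \<mu> h))"


subsection \<open>Well-definedness\<close>

lemma topspace_weak_topology: "topspace weak_topology = prob_measures"
proof
  show "topspace weak_topology \<subseteq> (prob_measures :: 'a measure set)"
    by (auto simp: weak_topology_def)
  have "continuous_on UNIV (\<lambda>_::'a. 0::real) \<and> bounded (range (\<lambda>_::'a. 0::real)) \<and> open (UNIV::real set)"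
    by auto
  then have "{M \<in> prob_measures. (\<integral>x. (0::real) \<partial>M) \<in> UNIV} \<in>
     {{M \<in> prob_measures. (\<integral>x. f x \<partial>M) \<in> U} | (f::'a\<Rightarrow>real) U.
        continuous_on UNIV f \<and> bounded (range f) \<and> open (U :: real set)}" by blast
  then show "(prob_measures :: 'a measure set) \<subseteq> topspace weak_topology"
    unfolding weak_topology_def topology_generated_by_topspace by blast
qed

lemma openin_weak_topology_subset: "{U. openin weak_topology U} \<subseteq> Pow prob_measures"
  using openin_subset[of weak_topology] by (auto simp: topspace_weak_topology)

lemma space_weak_borel: "space weak_borel = prob_measures"
  unfolding weak_borel_def by (rule space_measure_of[OF openin_weak_topology_subset])

lemma integral_measurable_weak_borel:
  fixes f :: "'x::topological_space \<Rightarrow> real"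
  assumes "continuous_on UNIV f" "bounded (range f)"
  shows "(\<lambda>M. \<integral>x. f x \<partial>M) \<in> borel_measurable weak_borel"
proof (rule borel_measurableI)
  fix S :: "real set" assume "open S"
  have "openin weak_topology {M \<in> prob_measures. (\<integral>x. f x \<partial>M) \<in> S}"
    unfolding weak_topology_def
    by (rule topology_generated_by_Basis) (use assms \<open>open S\<close> in blast)
  then have "{M \<in> prob_measures. (\<integral>x. f x \<partial>M) \<in> S} \<in> sets weak_borel"
    unfolding weak_borel_def by (intro in_measure_of[OF openin_weak_topology_subset]) simp
  moreover have "(\<lambda>M. \<integral>x. f x \<partial>M) -` S \<inter> space weak_borel = {M \<in> prob_measures. (\<integral>x. f x \<partial>M) \<in> S}"
    by (auto simp: space_weak_borel)
  ultimately show "(\<lambda>M. \<integral>x. f x \<partial>M) -` S \<inter> space weak_borel \<in> sets weak_borel" by simp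
qed

lemma measure_closed_measurable_weak_borel:
  fixes F :: "'x::metric_space set"
  assumes F: "closed F"
  shows "(\<lambda>M. measure M F) \<in> borel_measurable weak_borel"
proof (cases "F = {}")
  case False
  define f where "f k x = max 0 (1 - real k * infdist x F)" for k x
  have cont: "continuous_on UNIV (f k)" for k
    unfolding f_def by (intro continuous_intros)
  have bd: "0 \<le> f k x" "f k x \<le> 1" for k x
    by (auto simp: f_def infdist_nonneg)
  have "bounded (range (f k))" for k
    using bd by (intro boundedI[where B=1]) auto
  then have meas: "(\<lambda>M. \<integral>x. f k x \<partial>M) \<in> borel_measurable weak_borel" for k
    by (intro integral_measurable_weak_borel cont)
  have pt: "(\<lambda>k. f k x) \<longlonglongrightarrow> indicator F x" for x
  proof (cases "x \<in> F")
    case True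
    then show ?thesis by (simp add: f_def)
  next
    case nF: False
    then have pos: "0 < infdist x F" using F False by (simp add: infdist_pos_not_in_closed)
    obtain N where N: "1 < real N * infdist x F" using reals_Archimedean3[OF pos] by blast
    have "\<forall>\<^sub>F k in sequentially. f k x = 0"
      unfolding eventually_sequentially
    proof (intro exI allI impI)
      fix k assume "N \<le> k"
      then have "real N * infdist x F \<le> real k * infdist x F" using pos by simp
      then show "f k x = 0" using N by (simp add: f_def)
    qed
    then show ?thesis using nF by (simp add: tendsto_eventually)
  qed
  show ?thesis
  proof (rule borel_measurable_LIMSEQ_real[where u="\<lambda>k M. \<integral>x. f k x \<partial>M"])
    fix M :: "'x measure" assume "M \<in> space weak_borel"
    then have "prob_space M" and [measurable_cong]: "sets M = sets borel"
      by (auto simp: space_weak_borel prob_measures_def)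
    then interpret prob_space M by simp
    have [measurable]: "F \<in> sets M" using F by (simp add: \<open>sets M = sets borel\<close>)
    have [measurable]: "f k \<in> borel_measurable M" for k
      using borel_measurable_continuous_onI[OF cont] by measurable
    have "(\<lambda>k. \<integral>x. f k x \<partial>M) \<longlonglongrightarrow> (\<integral>x. indicator F x \<partial>M)"
      by (rule integral_dominated_convergence[where w="\<lambda>_. 1"]) (use pt bd in auto)
    then show "(\<lambda>k. \<integral>x. f k x \<partial>M) \<longlonglongrightarrow> measure M F"
      using sets.sets_into_space[OF \<open>F \<in> sets M\<close>] by (simp add: Int_absorb2)
  qed (use meas in simp)
qed simp

lemma weak_borel_measurable_prob_algebra:
  "(\<lambda>M. M) \<in> (weak_borel :: 'x::metric_space measure measure) \<rightarrow>\<^sub>M prob_algebra borel"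
proof -
  have "(\<lambda>M. M) \<in> (weak_borel :: 'x measure measure) \<rightarrow>\<^sub>M subprob_algebra borel"
  proof (rule measurable_subprob_algebra_generated[where \<Omega>=UNIV and G="Collect closed"])
    show "sets (borel :: 'x measure) = sigma_sets UNIV (Collect closed)"
      by (simp add: borel_eq_closed)
  next
    fix M :: "'x measure" assume "M \<in> space weak_borel"
    then show "subprob_space M" "sets M = sets borel"
      by (auto simp: space_weak_borel prob_measures_def prob_space_imp_subprob_space)
  next
    have *: "(\<lambda>M. emeasure M A) \<in> borel_measurable (weak_borel :: 'x measure measure)" if "closed A" for A
    proof -
      have "(\<lambda>M. ennreal (measure M A)) \<in> borel_measurable (weak_borel :: 'x measure measure)"
        using measure_closed_measurable_weak_borel[OF that] by measurable
      also have "?this \<longleftrightarrow> ?thesis"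
        by (intro measurable_cong)
           (auto simp: space_weak_borel prob_measures_def prob_space_def finite_measure.emeasure_eq_measure)
      finally show ?thesis .
    qed
    show "(\<lambda>M. emeasure M A) \<in> borel_measurable (weak_borel :: 'x measure measure)" if "A \<in> Collect closed" for A
      using * that by simp
    show "(\<lambda>M. emeasure M UNIV) \<in> borel_measurable (weak_borel :: 'x measure measure)"
      using *[of UNIV] by simp
  qed (auto simp: Int_stable_def)
  then show ?thesis
    unfolding prob_algebra_def
    by (intro measurable_restrict_space2) (auto simp: space_weak_borel prob_measures_def)
qed

lemma measurable_kernelD:
  fixes K :: "('s::{metric_space, second_countable_topology},
      'a::{metric_space, second_countable_topology}, 'y::metric_space) mf_kernel"
  assumes K: "measurable_kernel K" and m: "\<mu> \<in> prob_measures" "\<nu> \<in> prob_measures"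
  shows "(\<lambda>(s, a). K s \<mu> a \<nu>) \<in> borel \<Otimes>\<^sub>M borel \<rightarrow>\<^sub>M prob_algebra borel"
proof -
  have "(\<lambda>(s, a). (s, \<mu>, a, \<nu>)) \<in>
      borel \<Otimes>\<^sub>M borel \<rightarrow>\<^sub>M borel \<Otimes>\<^sub>M weak_borel \<Otimes>\<^sub>M borel \<Otimes>\<^sub>M weak_borel"
    using m by (auto simp: space_weak_borel intro!: measurable_Pair measurable_const simp: split_beta')
  from measurable_compose[OF measurable_compose[OF this K[unfolded measurable_kernel_def]]
      weak_borel_measurable_prob_algebra]
  show ?thesis by (simp add: split_beta')
qed

lemma controls_fromD:
  fixes \<pi> :: "('s::{metric_space, second_countable_topology},
      'a::{metric_space, second_countable_topology}) control"
  assumes "\<pi> \<in> controls_from k" "k \<le> t" and m: "\<mu> \<in> prob_measures"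
  shows "(\<lambda>s. \<pi> t s \<mu>) \<in> borel \<rightarrow>\<^sub>M prob_algebra borel"
proof -
  have *: "(\<lambda>(s, \<mu>). \<pi> t s \<mu>) \<in> borel \<Otimes>\<^sub>M weak_borel \<rightarrow>\<^sub>M weak_borel"
    using assms by (auto simp: controls_from_def)
  have "(\<lambda>s. (s, \<mu>)) \<in> borel \<rightarrow>\<^sub>M borel \<Otimes>\<^sub>M weak_borel"
    using m by (auto simp: space_weak_borel)
  from measurable_compose[OF measurable_compose[OF this *] weak_borel_measurable_prob_algebra]
  show ?thesis by simp
qed

lemma prob_measures_iff_space: "\<mu> \<in> prob_measures \<longleftrightarrow> \<mu> \<in> space (prob_algebra borel)"
  by (auto simp: prob_measures_def space_prob_algebra)

lemma bind_in_prob_measures: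
  assumes "\<mu> \<in> prob_measures" "h \<in> borel \<rightarrow>\<^sub>M prob_algebra borel"
  shows "\<mu> \<bind> h \<in> prob_measures"
  using assms prob_space_bind'[of \<mu> borel h borel] sets_bind'[of \<mu> borel h borel]
  by (simp add: prob_measures_iff_space) (simp add: space_prob_algebra)

context
  fixes P :: "('s::{metric_space, second_countable_topology},
      'a::{metric_space, second_countable_topology}, 's) mf_kernel"
    and R :: "('s, 'a, real) mf_kernel"
    and \<pi> :: "('s, 'a) control" and \<mu> :: "'s measure"
  assumes P: "measurable_kernel P" and R: "measurable_kernel R"
    and \<pi>: "\<pi> \<in> controls_from 0" and \<mu>: "\<mu> \<in> prob_measures"
begin

lemma mean_action_in_prob_measures:
  "m \<in> prob_measures \<Longrightarrow> mean_action m (\<lambda>s. \<pi> t s m) \<in> prob_measures"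
  unfolding mean_action_def by (intro bind_in_prob_measures controls_fromD[OF \<pi>]) auto

lemma inner_Phi_measurable:
  assumes m: "m \<in> prob_measures"
  shows "(\<lambda>s. \<pi> t s m \<bind> (\<lambda>a. P s m a (mean_action m (\<lambda>s. \<pi> t s m)))) \<in> borel \<rightarrow>\<^sub>M prob_algebra borel"
  by (rule measurable_bind_prob_space2[OF controls_fromD[OF \<pi> _ m]
        measurable_kernelD[OF P m mean_action_in_prob_measures[OF m]]]) simp

lemma state_law_in_prob_measures: "state_law P \<pi> \<mu> t \<in> prob_measures"
proof (induction t)
  case (Suc t)
  show ?case
    unfolding state_law.simps Phi_def by (intro bind_in_prob_measures Suc inner_Phi_measurable)
qed (simp add: \<mu>)

lemma action_law_in_prob_measures: "action_law P \<pi> \<mu> t \<in> prob_measures"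
  unfolding action_law_def by (intro mean_action_in_prob_measures state_law_in_prob_measures)

lemmas measurable_P = measurable_kernelD[OF P state_law_in_prob_measures action_law_in_prob_measures]
lemmas measurable_R = measurable_kernelD[OF R state_law_in_prob_measures action_law_in_prob_measures]
lemmas measurable_control = controls_fromD[OF \<pi> le0 state_law_in_prob_measures]

lemma act_kernel_measurable: "act_kernel P R \<pi> \<mu> t \<in> borel \<rightarrow>\<^sub>M prob_algebra step_space"
proof -
  have "(\<lambda>s. act_kernel P R \<pi> \<mu> t s) \<in> borel \<rightarrow>\<^sub>M prob_algebra step_space"
    unfolding act_kernel_def
  proof (rule measurable_bind_prob_space2[OF measurable_control])
    have 1: "(\<lambda>p. R (fst p) (state_law P \<pi> \<mu> t) (snd p) (action_law P \<pi> \<mu> t))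
        \<in> borel \<Otimes>\<^sub>M borel \<rightarrow>\<^sub>M prob_algebra borel"
      using measurable_R by (simp add: split_beta')
    have "(\<lambda>p. R (fst p) (state_law P \<pi> \<mu> t) (snd p) (action_law P \<pi> \<mu> t) \<bind>
        (\<lambda>r. return step_space (fst p, snd p, r))) \<in> borel \<Otimes>\<^sub>M borel \<rightarrow>\<^sub>M prob_algebra step_space"
      by (rule measurable_bind_prob_space2[OF 1]) measurable
    then show "(\<lambda>(s, a). R s (state_law P \<pi> \<mu> t) a (action_law P \<pi> \<mu> t) \<bind>
        (\<lambda>r. return step_space (s, a, r))) \<in> borel \<Otimes>\<^sub>M borel \<rightarrow>\<^sub>M prob_algebra step_space"
      by (simp add: split_beta')
  qed
  then show ?thesis by simp
qed

lemma step_kernel_Suc_measurable: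
  "(\<lambda>(s, a, r). P s (state_law P \<pi> \<mu> t) a (action_law P \<pi> \<mu> t) \<bind> act_kernel P R \<pi> \<mu> (Suc t))
     \<in> step_space \<rightarrow>\<^sub>M prob_algebra step_space"
proof -
  have "(\<lambda>x. (fst x, fst (snd x))) \<in> (step_space :: ('s \<times> 'a \<times> real) measure) \<rightarrow>\<^sub>M borel \<Otimes>\<^sub>M borel"
    by measurable
  from measurable_compose[OF this measurable_P]
  have 1: "(\<lambda>x. P (fst x) (state_law P \<pi> \<mu> t) (fst (snd x)) (action_law P \<pi> \<mu> t))
      \<in> (step_space :: ('s \<times> 'a \<times> real) measure) \<rightarrow>\<^sub>M prob_algebra borel" by simp
  have "(\<lambda>x. P (fst x) (state_law P \<pi> \<mu> t) (fst (snd x)) (action_law P \<pi> \<mu> t) \<bind>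
      act_kernel P R \<pi> \<mu> (Suc t)) \<in> (step_space :: ('s \<times> 'a \<times> real) measure) \<rightarrow>\<^sub>M prob_algebra step_space"
    by (rule measurable_bind_prob_space[OF 1 act_kernel_measurable])
  then show ?thesis by (simp add: split_beta')
qed

lemma step_kernel_measurable:
  "step_kernel P R \<pi> \<mu> t \<in> PiM {0..<t} (\<lambda>_. step_space) \<rightarrow>\<^sub>M prob_algebra step_space"
proof (cases t)
  case 0
  have "\<mu> \<bind> act_kernel P R \<pi> \<mu> 0 \<in> space (prob_algebra step_space)"
    using \<mu> act_kernel_measurable[of 0] prob_space_bind'[of \<mu> borel _ step_space]
      sets_bind'[of \<mu> borel _ step_space]
    by (auto simp: prob_measures_iff_space space_prob_algebra)
  then show ?thesis
    unfolding 0 by (subst measurable_cong[where g="\<lambda>_. \<mu> \<bind> act_kernel P R \<pi> \<mu> 0"]) auto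
next
  case (Suc n)
  have "(\<lambda>\<omega>. \<omega> n) \<in> PiM {0..<Suc n} (\<lambda>_. step_space) \<rightarrow>\<^sub>M (step_space :: ('s \<times> 'a \<times> real) measure)"
    by (rule measurable_component_singleton) simp
  from measurable_compose[OF this step_kernel_Suc_measurable]
  show ?thesis unfolding Suc by (simp add: split_beta' cong: measurable_cong)
qed

lemma Ionescu_Tulcea_step_kernel:
  "Ionescu_Tulcea (step_kernel P R \<pi> \<mu>) (\<lambda>_. step_space)"
proof (rule Ionescu_Tulcea.intro)
  show "step_kernel P R \<pi> \<mu> t \<in> PiM {0..<t} (\<lambda>_. step_space) \<rightarrow>\<^sub>M subprob_algebra step_space" for t
    by (rule measurable_prob_algebraD[OF step_kernel_measurable])
  show "prob_space (step_kernel P R \<pi> \<mu> t x)" if "x \<in> space (PiM {0..<t} (\<lambda>_. step_space))" for t x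
    using measurable_space[OF step_kernel_measurable that] by (simp add: space_prob_algebra)
qed

interpretation IT: Ionescu_Tulcea "step_kernel P R \<pi> \<mu>" "\<lambda>_. step_space"
  by (rule Ionescu_Tulcea_step_kernel)

lemma trajectory_law_eq: "trajectory_law P R \<pi> \<mu> = IT.PF.lim"
  by (simp add: trajectory_law_def)

lemma sets_trajectory_law: "sets (trajectory_law P R \<pi> \<mu>) = sets (PiM UNIV (\<lambda>_. step_space))"
  by (simp add: trajectory_law_eq)

lemma distr_trajectory_law_step:
  shows distr_trajectory_law_C: "distr (trajectory_law P R \<pi> \<mu>) step_space (\<lambda>\<omega>. \<omega> t) =
     distr (IT.C 0 (Suc t) (\<lambda>_. undefined)) step_space (\<lambda>\<omega>. \<omega> t)" (is ?th1)
  and distr_trajectory_law_bind: "distr (trajectory_law P R \<pi> \<mu>) step_space (\<lambda>\<omega>. \<omega> t) =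
     IT.C 0 t (\<lambda>_. undefined) \<bind> step_kernel P R \<pi> \<mu> t" (is ?th2)
proof -
  let ?u = "\<lambda>_::nat. undefined" and ?B = "step_space :: ('s \<times> 'a \<times> real) measure"
  have u: "?u \<in> space (PiM {0..<0} (\<lambda>_. ?B))"
    by (simp add: space_PiM PiE_iff extensional_def)
  have up: "IT.up_to {0..<Suc t} = Suc t"
    by (intro antisym) (auto simp: IT.up_to_iff IT.up_to_less Suc_le_eq)
  have comp: "(\<lambda>\<omega>. \<omega> t) \<in> PiM {0..<Suc t} (\<lambda>_. ?B) \<rightarrow>\<^sub>M ?B"
    by (rule measurable_component_singleton) simp
  have "distr IT.PF.lim ?B (\<lambda>\<omega>. \<omega> t) =
      distr (distr IT.PF.lim (PiM {0..<Suc t} (\<lambda>_. ?B)) (\<lambda>x. restrict x {0..<Suc t})) ?B (\<lambda>\<omega>. \<omega> t)"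
    by (subst distr_distr[OF comp])
       (auto simp: comp_def measurable_cong_sets[OF IT.PF.sets_lim refl] intro!: measurable_restrict_subset)
  also have "\<dots> = distr (IT.CI {0..<Suc t}) ?B (\<lambda>\<omega>. \<omega> t)"
    by (subst IT.distr_lim) auto
  also have "\<dots> = distr (IT.C 0 (Suc t) ?u) ?B (\<lambda>\<omega>. \<omega> t)"
  proof -
    have s: "sets (IT.C 0 (Suc t) ?u) = sets (PiM {0..<Suc t} (\<lambda>_. ?B))"
      using IT.sets_C[OF u, of "Suc t"] by simp
    show ?thesis
      unfolding IT.CI_def up
      by (subst distr_distr[OF comp])
         (auto simp: comp_def measurable_cong_sets[OF s refl] simp del: IT.C.simps intro!: measurable_restrict_subset)
  qed
  finally show C: ?th1 by (simp add: trajectory_law_eq del: IT.C.simps)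
  note C
  also have "distr (IT.C 0 (Suc t) ?u) ?B (\<lambda>\<omega>. \<omega> t) = IT.C 0 t ?u \<bind> (\<lambda>\<omega>. distr (IT.eP t \<omega>) ?B (\<lambda>\<omega>. \<omega> t))"
  proof -
    have s: "sets (IT.C 0 t ?u) = sets (PiM {0..<t} (\<lambda>_. ?B))"
      using IT.sets_C[OF u, of t] by simp
    have "IT.eP t \<in> IT.C 0 t ?u \<rightarrow>\<^sub>M subprob_algebra (PiM {0..<Suc t} (\<lambda>_. ?B))"
      unfolding measurable_cong_sets[OF s refl] by (rule IT.measurable_eP)
    from distr_bind[OF this prob_space.not_empty[OF IT.prob_space_C[OF u]] comp]
    show ?thesis by simp
  qed
  also have "\<dots> = IT.C 0 t ?u \<bind> step_kernel P R \<pi> \<mu> t"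
  proof (rule bind_cong[OF refl])
    fix \<omega> assume "\<omega> \<in> space (IT.C 0 t ?u)"
    then have w: "\<omega> \<in> space (PiM {0..<t} (\<lambda>_. ?B))" using IT.space_C[OF u] by simp
    show "distr (IT.eP t \<omega>) ?B (\<lambda>\<omega>. \<omega> t) = step_kernel P R \<pi> \<mu> t \<omega>"
      unfolding IT.eP_def
      by (subst distr_distr[OF comp])
         (auto simp: comp_def IT.sets_P[OF w] measurable_cong_sets[OF IT.sets_P[OF w] refl] w
           intro!: measurable_fun_upd[where J="{0..<t}"] distr_id2)
  qed
  finally show ?th2 .
qed

lemma act_kernel_bind:
  assumes g: "g \<in> borel \<Otimes>\<^sub>M borel \<rightarrow>\<^sub>M prob_algebra N"
  shows "act_kernel P R \<pi> \<mu> t s \<bind> (\<lambda>(s, a, r). g (s, a)) =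
    \<pi> t s (state_law P \<pi> \<mu> t) \<bind> (\<lambda>a. g (s, a))"
proof -
  let ?m = "state_law P \<pi> \<mu> t" and ?n = "action_law P \<pi> \<mu> t"
  let ?g = "\<lambda>(s, a, r::real). g (s, a)"
  have "(\<lambda>x. g (fst x, fst (snd x))) \<in> (step_space :: ('s \<times> 'a \<times> real) measure) \<rightarrow>\<^sub>M prob_algebra N"
    by (rule measurable_compose[OF _ g]) measurable
  then have g': "?g \<in> (step_space :: ('s \<times> 'a \<times> real) measure) \<rightarrow>\<^sub>M subprob_algebra N"
    by (intro measurable_prob_algebraD) (simp add: split_beta')
  have Rsa: "R s ?m a ?n \<in> space (prob_algebra borel)" for a
    using measurable_space[OF measurable_R, of "(s, a)"] by (simp add: space_pair_measure)
  have c: "\<pi> t s ?m \<in> space (prob_algebra borel)"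
    using measurable_space[OF measurable_control, of s] by simp
  have inner: "(\<lambda>a. R s ?m a ?n \<bind> (\<lambda>r. return step_space (s, a, r)))
      \<in> borel \<rightarrow>\<^sub>M prob_algebra step_space"
  proof (rule measurable_bind_prob_space2)
    show "(\<lambda>a. R s ?m a ?n) \<in> borel \<rightarrow>\<^sub>M prob_algebra borel"
      using measurable_compose[OF measurable_Pair1'[of s borel] measurable_R] by simp
    show "(\<lambda>(a, r). return step_space (s, a, r)) \<in> borel \<Otimes>\<^sub>M borel \<rightarrow>\<^sub>M prob_algebra step_space"
      by measurable
  qed
  have "act_kernel P R \<pi> \<mu> t s \<bind> ?g =
      \<pi> t s ?m \<bind> (\<lambda>a. (R s ?m a ?n \<bind> (\<lambda>r. return step_space (s, a, r))) \<bind> ?g)"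
    unfolding act_kernel_def
    using measurable_prob_algebraD[OF inner] c
    by (intro bind_assoc[OF _ g']) (simp add: space_prob_algebra cong: measurable_cong_sets)
  also have "\<dots> = \<pi> t s ?m \<bind> (\<lambda>a. g (s, a))"
  proof (rule bind_cong[OF refl])
    fix a
    have "(R s ?m a ?n \<bind> (\<lambda>r. return step_space (s, a, r))) \<bind> ?g =
        R s ?m a ?n \<bind> (\<lambda>r. return step_space (s, a, r) \<bind> ?g)"
    proof (rule bind_assoc[OF _ g'])
      have "(\<lambda>r. return step_space (s, a, r)) \<in> borel \<rightarrow>\<^sub>M subprob_algebra step_space"
        by measurable
      then show "(\<lambda>r. return step_space (s, a, r)) \<in> R s ?m a ?n \<rightarrow>\<^sub>M subprob_algebra step_space"
        using Rsa[of a] by (simp add: space_prob_algebra cong: measurable_cong_sets)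
    qed
    also have "\<dots> = R s ?m a ?n \<bind> (\<lambda>r. g (s, a))"
      by (intro bind_cong refl) (subst bind_return[OF g'], auto simp: space_pair_measure)
    also have "\<dots> = g (s, a)"
    proof (rule bind_const')
      show "prob_space (R s ?m a ?n)" using Rsa[of a] by (simp add: space_prob_algebra)
      show "subprob_space (g (s, a))"
        using measurable_space[OF g, of "(s, a)"]
        by (auto simp: space_pair_measure space_prob_algebra prob_space_imp_subprob_space)
    qed
    finally show "(R s ?m a ?n \<bind> (\<lambda>r. return step_space (s, a, r))) \<bind> ?g = g (s, a)" .
  qed
  finally show ?thesis .
qed

lemma bind_state_law_assoc:
  assumes f: "f \<in> borel \<rightarrow>\<^sub>M prob_algebra N" and g: "g \<in> N \<rightarrow>\<^sub>M prob_algebra L"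
  shows "(state_law P \<pi> \<mu> t \<bind> f) \<bind> g = state_law P \<pi> \<mu> t \<bind> (\<lambda>s. f s \<bind> g)"
  using state_law_in_prob_measures[of t] measurable_prob_algebraD[OF f]
  by (intro bind_assoc[OF _ measurable_prob_algebraD[OF g]])
     (simp add: prob_measures_def cong: measurable_cong_sets)

lemma distr_trajectory_law:
  "distr (trajectory_law P R \<pi> \<mu>) step_space (\<lambda>\<omega>. \<omega> t) = state_law P \<pi> \<mu> t \<bind> act_kernel P R \<pi> \<mu> t"
proof (induction t)
  case 0
  have "return (PiM {0..<0} (\<lambda>_. step_space)) (\<lambda>_. undefined) \<bind> step_kernel P R \<pi> \<mu> 0 =
      step_kernel P R \<pi> \<mu> 0 (\<lambda>_. undefined)"
    by (rule bind_return[OF measurable_prob_algebraD[OF step_kernel_measurable]]) simp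
  then show ?case by (simp add: distr_trajectory_law_bind)
next
  case (Suc t)
  let ?u = "\<lambda>_::nat. undefined" and ?B = "step_space :: ('s \<times> 'a \<times> real) measure"
  let ?m = "state_law P \<pi> \<mu> t" and ?n = "action_law P \<pi> \<mu> t"
  let ?g = "\<lambda>(s, a). P s ?m a ?n \<bind> act_kernel P R \<pi> \<mu> (Suc t)"
  let ?k = "\<lambda>(s, a, r). ?g (s, a)"
  have u: "?u \<in> space (PiM {0..<0} (\<lambda>_. ?B))"
    by (simp add: space_PiM PiE_iff extensional_def)
  have k: "?k \<in> ?B \<rightarrow>\<^sub>M prob_algebra ?B"
    using step_kernel_Suc_measurable[of t] by simp
  have g: "?g \<in> borel \<Otimes>\<^sub>M borel \<rightarrow>\<^sub>M prob_algebra ?B"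
    using measurable_bind_prob_space[OF measurable_P act_kernel_measurable[of "Suc t"], of t]
    by (simp add: split_beta')
  have comp: "(\<lambda>\<omega>. \<omega> t) \<in> IT.C 0 (Suc t) ?u \<rightarrow>\<^sub>M ?B"
    using measurable_cong_sets[OF IT.sets_C[OF u, of "Suc t"] refl, of ?B]
    by (simp del: IT.C.simps)
  have "distr (trajectory_law P R \<pi> \<mu>) ?B (\<lambda>\<omega>. \<omega> (Suc t)) =
      IT.C 0 (Suc t) ?u \<bind> step_kernel P R \<pi> \<mu> (Suc t)"
    by (rule distr_trajectory_law_bind)
  also have "\<dots> = IT.C 0 (Suc t) ?u \<bind> (\<lambda>\<omega>. ?k (\<omega> t))"
    by (intro bind_cong refl) (simp add: split_beta')
  also have "\<dots> = distr (IT.C 0 (Suc t) ?u) ?B (\<lambda>\<omega>. \<omega> t) \<bind> ?k"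
    by (rule bind_distr[symmetric, OF comp measurable_prob_algebraD[OF k]
          prob_space.not_empty[OF IT.prob_space_C[OF u]]])
  also have "\<dots> = (?m \<bind> act_kernel P R \<pi> \<mu> t) \<bind> ?k"
    unfolding distr_trajectory_law_C[symmetric] Suc ..
  also have "\<dots> = ?m \<bind> (\<lambda>s. act_kernel P R \<pi> \<mu> t s \<bind> ?k)"
    by (rule bind_state_law_assoc[OF act_kernel_measurable k])
  also have "\<dots> = ?m \<bind> (\<lambda>s. \<pi> t s ?m \<bind> (\<lambda>a. ?g (s, a)))"
    by (simp only: act_kernel_bind[OF g])
  also have "\<dots> = ?m \<bind> (\<lambda>s. (\<pi> t s ?m \<bind> (\<lambda>a. P s ?m a ?n)) \<bind> act_kernel P R \<pi> \<mu> (Suc t))"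
  proof (rule bind_cong[OF refl])
    fix s
    have "(\<lambda>a. P s ?m a ?n) \<in> borel \<rightarrow>\<^sub>M subprob_algebra borel"
      using measurable_compose[OF measurable_Pair1'[of s borel] measurable_prob_algebraD[OF measurable_P]]
      by simp
    moreover have "sets (\<pi> t s ?m) = sets borel"
      using measurable_space[OF measurable_control, of s] by (simp add: space_prob_algebra)
    ultimately have "(\<lambda>a. P s ?m a ?n) \<in> \<pi> t s ?m \<rightarrow>\<^sub>M subprob_algebra borel"
      by (simp cong: measurable_cong_sets)
    from bind_assoc[OF this measurable_prob_algebraD[OF act_kernel_measurable]]
    show "\<pi> t s ?m \<bind> (\<lambda>a. ?g (s, a)) =
        (\<pi> t s ?m \<bind> (\<lambda>a. P s ?m a ?n)) \<bind> act_kernel P R \<pi> \<mu> (Suc t)" by simp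
  qed
  also have "\<dots> = (?m \<bind> (\<lambda>s. \<pi> t s ?m \<bind> (\<lambda>a. P s ?m a ?n))) \<bind> act_kernel P R \<pi> \<mu> (Suc t)"
    using inner_Phi_measurable[OF state_law_in_prob_measures, of t t]
    by (intro bind_state_law_assoc[symmetric, OF _ act_kernel_measurable]) (simp add: action_law_def)
  also have "?m \<bind> (\<lambda>s. \<pi> t s ?m \<bind> (\<lambda>a. P s ?m a ?n)) = state_law P \<pi> \<mu> (Suc t)"
    by (simp add: Phi_def action_law_def)
  finally show ?case .
qed

lemma distr_trajectory_law_image:
  assumes f: "f \<in> borel \<Otimes>\<^sub>M borel \<rightarrow>\<^sub>M N"
  shows "distr (trajectory_law P R \<pi> \<mu>) N (\<lambda>\<omega>. f (fst (\<omega> t), fst (snd (\<omega> t)))) =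
    state_law P \<pi> \<mu> t \<bind> (\<lambda>s. \<pi> t s (state_law P \<pi> \<mu> t) \<bind> (\<lambda>a. return N (f (s, a))))"
proof -
  let ?B = "step_space :: ('s \<times> 'a \<times> real) measure"
  let ?k = "\<lambda>x. return N (f x)"
  have comp: "(\<lambda>\<omega>. \<omega> t) \<in> trajectory_law P R \<pi> \<mu> \<rightarrow>\<^sub>M ?B"
    unfolding measurable_cong_sets[OF sets_trajectory_law refl]
    by (rule measurable_component_singleton) simp
  have ne: "space (trajectory_law P R \<pi> \<mu>) \<noteq> {}"
    unfolding sets_eq_imp_space_eq[OF sets_trajectory_law] by (simp add: space_PiM_empty_iff space_pair_measure)
  have k: "?k \<in> borel \<Otimes>\<^sub>M borel \<rightarrow>\<^sub>M prob_algebra N"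
    by (rule measurable_compose[OF f measurable_return_prob_space])
  have fB: "(\<lambda>x. f (fst x, fst (snd x))) \<in> ?B \<rightarrow>\<^sub>M N"
    by (rule measurable_compose[OF _ f]) measurable
  have kB: "(\<lambda>(s, a, r). ?k (s, a)) \<in> ?B \<rightarrow>\<^sub>M prob_algebra N"
    using measurable_compose[OF fB measurable_return_prob_space] by (simp add: split_beta')
  have "distr (trajectory_law P R \<pi> \<mu>) N (\<lambda>\<omega>. f (fst (\<omega> t), fst (snd (\<omega> t)))) =
      distr (trajectory_law P R \<pi> \<mu>) ?B (\<lambda>\<omega>. \<omega> t) \<bind> (\<lambda>x. return N (f (fst x, fst (snd x))))"
    by (rule bind_distr_return[symmetric, OF comp fB ne])
  also have "\<dots> = (state_law P \<pi> \<mu> t \<bind> act_kernel P R \<pi> \<mu> t) \<bind> (\<lambda>(s, a, r). ?k (s, a))"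
    by (simp add: distr_trajectory_law split_beta')
  also have "\<dots> = state_law P \<pi> \<mu> t \<bind> (\<lambda>s. act_kernel P R \<pi> \<mu> t s \<bind> (\<lambda>(s, a, r). ?k (s, a)))"
    by (rule bind_state_law_assoc[OF act_kernel_measurable kB])
  also have "\<dots> = state_law P \<pi> \<mu> t \<bind> (\<lambda>s. \<pi> t s (state_law P \<pi> \<mu> t) \<bind> (\<lambda>a. ?k (s, a)))"
    by (simp only: act_kernel_bind[OF k])
  finally show ?thesis .
qed

lemma sets_control: "sets (\<pi> t s (state_law P \<pi> \<mu> t)) = sets borel"
  and prob_space_control: "prob_space (\<pi> t s (state_law P \<pi> \<mu> t))"
  using measurable_space[OF measurable_control, of s t] by (simp_all add: space_prob_algebra)

lemma distr_state_trajectory_law: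
  "distr (trajectory_law P R \<pi> \<mu>) borel (\<lambda>\<omega>. fst (\<omega> t)) = state_law P \<pi> \<mu> t"
proof -
  have "distr (trajectory_law P R \<pi> \<mu>) borel (\<lambda>\<omega>. fst (\<omega> t)) =
      state_law P \<pi> \<mu> t \<bind> (\<lambda>s. \<pi> t s (state_law P \<pi> \<mu> t) \<bind> (\<lambda>a. return borel s))"
    using distr_trajectory_law_image[OF measurable_fst, of t] by (simp only: fst_conv)
  also have "\<dots> = state_law P \<pi> \<mu> t \<bind> return borel"
    by (intro bind_cong refl bind_const' prob_space_control subprob_space_return) simp
  also have "\<dots> = state_law P \<pi> \<mu> t"
    using state_law_in_prob_measures[of t] by (intro bind_return'') (simp add: prob_measures_def)
  finally show ?thesis .
qed

lemma distr_action_trajectory_law: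
  "distr (trajectory_law P R \<pi> \<mu>) borel (\<lambda>\<omega>. fst (snd (\<omega> t))) = action_law P \<pi> \<mu> t"
proof -
  have "distr (trajectory_law P R \<pi> \<mu>) borel (\<lambda>\<omega>. fst (snd (\<omega> t))) =
      state_law P \<pi> \<mu> t \<bind> (\<lambda>s. \<pi> t s (state_law P \<pi> \<mu> t) \<bind> return borel)"
    using distr_trajectory_law_image[OF measurable_snd, of t] by (simp only: snd_conv)
  also have "\<dots> = action_law P \<pi> \<mu> t"
    unfolding action_law_def mean_action_def
    by (rule bind_cong[OF refl]) (rule bind_return''[OF sets_control])
  finally show ?thesis .
qed

end

end

theory Submission
  imports Defs
begin

text \<open>
  Because the laws \<open>\<mu>\<^sub>t\<close> of the states evolve deterministically, the mean-field control problem is a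
  deterministic control problem on the space of measures: its state is \<open>\<mu>\<close>, its action is a local
  policy \<open>h\<close>, the transition is \<open>\<mu> \<mapsto> \<Phi>(\<mu>, h)\<close>, and the reward is \<open>rhat R \<mu> h\<close>. Lemma
  \<open>expected_return_sums\<close> carries out this reduction: once the absolute return is finite, the sum over
  time and the expectation may be exchanged, and the return is the series of the \<open>\<gamma>\<^sup>t\<close>-weighted
  rewards \<open>rhat\<close> along the flow of laws. Removing the head of that series gives a Bellman equation
  for each fixed control (\<open>expected_return_step\<close>).

  To pass to the supremum, note that the continuation of a control from time 1 on and a pair
  consisting of a local policy and a control from time 1 on yield the same returns. A continuation
  \<open>\<sigma>\<close> started in the law \<open>\<mu>'\<close> uses its first control only at \<open>\<mu>'\<close>, so it may be replaced by
  the local policy \<open>\<lambda>s. \<sigma> 0 s \<mu>'\<close> (\<open>expected_return_eq_IQ_policy\<close>); conversely such a pair,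
  delayed by one step, is a continuation. Hence the two suprema agree, without any
  measurable selection: the law reached after one step is a single measure, and the control has to be
  near-optimal only there. The integrability assumption holds for all relaxed controls, which makes
  every measurable map a local policy.
\<close>

section \<open>Expected rewards along the flow of laws\<close>

text \<open>The integrand need not be bounded; the positive and the negative part are each handled by the
  corresponding fact for nonnegative functions. The inner integral on the right may be undefined on
  a null set, where it has the value 0.\<close>

lemma integral_bind_integrable:
  fixes f :: "'b \<Rightarrow> real"
  assumes N: "N \<in> M \<rightarrow>\<^sub>M subprob_algebra B" and f: "f \<in> borel_measurable B"
    and ne: "space M \<noteq> {}" and int: "integrable (M \<bind> N) f"
  shows "AE x in M. integrable (N x) f"
    and "(\<integral>y. f y \<partial>(M \<bind> N)) = (\<integral>x. (\<integral>y. f y \<partial>N x) \<partial>M)"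
proof -
  note [measurable] = N f
  define p where "p g x = (\<integral>\<^sup>+y. ennreal (g y) \<partial>N x)" for g :: "'b \<Rightarrow> real" and x
  have meas: "p g \<in> borel_measurable M" if "g \<in> borel_measurable B" for g
    unfolding p_def using that by measurable
  have bind: "(\<integral>\<^sup>+y. ennreal (g y) \<partial>(M \<bind> N)) = (\<integral>\<^sup>+x. p g x \<partial>M)"
    if "g \<in> borel_measurable B" for g
    unfolding p_def using that by (intro nn_integral_bind[OF _ N]) measurable
  have abs_fin: "(\<integral>\<^sup>+x. p (\<lambda>y. \<bar>f y\<bar>) x \<partial>M) < \<infinity>"
    using int bind[of "\<lambda>y. \<bar>f y\<bar>"] by (simp add: integrable_iff_bounded)
  have fin: "(\<integral>\<^sup>+x. p g x \<partial>M) < \<infinity>" if "\<And>y. g y \<le> \<bar>f y\<bar>" for g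
    using abs_fin that unfolding p_def
    by (auto intro!: nn_integral_mono ennreal_leI elim!: le_less_trans[rotated])
  have AE_fin: "AE x in M. p g x < \<infinity>" if "g \<in> borel_measurable B" "\<And>y. g y \<le> \<bar>f y\<bar>" for g
    using nn_integral_PInf_AE[OF meas[OF that(1)]] fin[OF that(2)] by (auto simp: less_top)
  have p_int: "integrable M (\<lambda>x. enn2real (p g x))"
    and p_eq: "enn2real (\<integral>\<^sup>+x. p g x \<partial>M) = (\<integral>x. enn2real (p g x) \<partial>M)"
    if g: "g \<in> borel_measurable B" "\<And>y. g y \<le> \<bar>f y\<bar>" for g
  proof -
    note [measurable] = meas[OF g(1)]
    have eq: "(\<integral>\<^sup>+x. ennreal (enn2real (p g x)) \<partial>M) = (\<integral>\<^sup>+x. p g x \<partial>M)"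
      using AE_fin[OF g] by (intro nn_integral_cong_AE) (auto simp: less_top)
    show "integrable M (\<lambda>x. enn2real (p g x))"
      using fin[OF g(2)] by (intro integrableI_nonneg) (auto simp: eq)
    show "enn2real (\<integral>\<^sup>+x. p g x \<partial>M) = (\<integral>x. enn2real (p g x) \<partial>M)"
      by (subst integral_eq_nn_integral) (auto simp: eq)
  qed
  show int_AE: "AE x in M. integrable (N x) f"
  proof -
    have "AE x in M. p (\<lambda>y. \<bar>f y\<bar>) x < \<infinity>"
      by (rule AE_fin) auto
    with AE_space show ?thesis
    proof eventually_elim
      case (elim x)
      have "sets (N x) = sets B" using elim(1) by (rule sets_kernel[OF N])
      then show ?case
        using elim(2) f by (simp add: integrable_iff_bounded p_def cong: measurable_cong_sets)
    qed
  qed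
  have "(\<integral>x. (\<integral>y. f y \<partial>N x) \<partial>M) = (\<integral>x. enn2real (p f x) - enn2real (p (\<lambda>y. - f y) x) \<partial>M)"
  proof (rule integral_cong_AE)
    show "(\<lambda>x. \<integral>y. f y \<partial>N x) \<in> borel_measurable M" by measurable
    show "(\<lambda>x. enn2real (p f x) - enn2real (p (\<lambda>y. - f y) x)) \<in> borel_measurable M"
      using meas[of f] meas[of "\<lambda>y. - f y"] by measurable
    show "AE x in M. (\<integral>y. f y \<partial>N x) = enn2real (p f x) - enn2real (p (\<lambda>y. - f y) x)"
      using int_AE by eventually_elim (simp add: real_lebesgue_integral_def p_def)
  qed
  also have "\<dots> = (\<integral>x. enn2real (p f x) \<partial>M) - (\<integral>x. enn2real (p (\<lambda>y. - f y) x) \<partial>M)"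
    by (intro Bochner_Integration.integral_diff p_int) auto
  also have "\<dots> = (\<integral>y. f y \<partial>(M \<bind> N))"
    by (simp add: real_lebesgue_integral_def[OF int] bind p_eq)
  finally show "(\<integral>y. f y \<partial>(M \<bind> N)) = (\<integral>x. (\<integral>y. f y \<partial>N x) \<partial>M)" ..
qed

lemma integral_reward:
  fixes P :: "('s::{metric_space, second_countable_topology},
      'a::{metric_space, second_countable_topology}, 's) mf_kernel"
    and R :: "('s, 'a, real) mf_kernel"
  assumes ker: "measurable_kernel P" "measurable_kernel R"
    and \<pi>: "\<pi> \<in> controls_from 0" and \<mu>: "\<mu> \<in> prob_measures"
    and int: "integrable (trajectory_law P R \<pi> \<mu>) (reward t)"
  shows "(\<integral>\<omega>. reward t \<omega> \<partial>trajectory_law P R \<pi> \<mu>) =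
    rhat R (state_law P \<pi> \<mu> t) (\<lambda>s. \<pi> t s (state_law P \<pi> \<mu> t))"
proof -
  note asm = ker \<pi> \<mu>
  let ?B = "step_space :: ('s \<times> 'a \<times> real) measure"
  let ?T = "trajectory_law P R \<pi> \<mu>"
  let ?m = "state_law P \<pi> \<mu> t" and ?n = "action_law P \<pi> \<mu> t"
  let ?K = "act_kernel P R \<pi> \<mu> t"
  let ?f = "\<lambda>x :: 's \<times> 'a \<times> real. snd (snd x)"
  let ?L = "\<lambda>s a. R s ?m a ?n \<bind> (\<lambda>r. return ?B (s, a, r))"
  have comp: "(\<lambda>\<omega>. \<omega> t) \<in> ?T \<rightarrow>\<^sub>M ?B"
    unfolding measurable_cong_sets[OF sets_trajectory_law[OF asm] refl]
    by (rule measurable_component_singleton) simp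
  have f: "?f \<in> borel_measurable ?B" by measurable
  have m: "sets ?m = sets borel"
    using state_law_in_prob_measures[OF asm] by (auto simp: prob_measures_def)
  have K: "?K \<in> ?m \<rightarrow>\<^sub>M subprob_algebra ?B"
    using measurable_prob_algebraD[OF act_kernel_measurable[OF asm]]
    by (simp add: measurable_cong_sets[OF m refl])
  have ne: "space ?m \<noteq> {}" using sets_eq_imp_space_eq[OF m] by simp
  have R0: "(\<lambda>x. R (fst x) ?m (snd x) ?n) \<in> borel \<Otimes>\<^sub>M borel \<rightarrow>\<^sub>M prob_algebra borel"
    using measurable_R[OF asm] by (simp add: split_beta')
  have Rs: "(\<lambda>a. R s ?m a ?n) \<in> borel \<rightarrow>\<^sub>M prob_algebra borel" for s
    using measurable_compose[OF measurable_Pair1'[of s borel] measurable_R[OF asm]] by simp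
  have setsR: "sets (R s ?m a ?n) = sets borel" for s a
    using measurable_space[OF Rs, of a] by (simp add: space_prob_algebra)
  have L: "(\<lambda>a. ?L s a) \<in> \<pi> t s ?m \<rightarrow>\<^sub>M subprob_algebra ?B" for s
  proof -
    have "(\<lambda>(a, r). return ?B (s, a, r)) \<in> borel \<Otimes>\<^sub>M borel \<rightarrow>\<^sub>M prob_algebra ?B" by measurable
    from measurable_prob_algebraD[OF measurable_bind_prob_space2[OF Rs this]]
    show ?thesis by (simp add: measurable_cong_sets[OF sets_control[OF asm] refl])
  qed
  have cne: "space (\<pi> t s ?m) \<noteq> {}" for s
    using sets_eq_imp_space_eq[OF sets_control[OF asm, of t s]] by simp
  have L_int: "(\<integral>x. ?f x \<partial>?L s a) = (\<integral>r. r \<partial>R s ?m a ?n)" for s a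
  proof -
    have pair: "(\<lambda>r. (s, a, r)) \<in> R s ?m a ?n \<rightarrow>\<^sub>M ?B"
      by (simp add: measurable_cong_sets[OF setsR refl])
    have "?L s a = distr (R s ?m a ?n) ?B (\<lambda>r. (s, a, r))"
      using sets_eq_imp_space_eq[OF setsR, of s a]
      by (subst bind_return_distr[OF _ pair, symmetric]) (auto simp: comp_def)
    then show ?thesis by (simp add: integral_distr[OF pair f])
  qed
  have distr: "distr ?T ?B (\<lambda>\<omega>. \<omega> t) = ?m \<bind> ?K"
    by (rule distr_trajectory_law[OF asm])
  have int': "integrable (?m \<bind> ?K) ?f"
    using int unfolding distr[symmetric] by (subst integrable_distr_eq[OF comp f]) (simp add: reward_def[abs_def])
  have "(\<integral>\<omega>. reward t \<omega> \<partial>?T) = (\<integral>x. ?f x \<partial>(?m \<bind> ?K))"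
    unfolding distr[symmetric] reward_def by (rule integral_distr[OF comp f, symmetric])
  also have "\<dots> = (\<integral>s. (\<integral>x. ?f x \<partial>?K s) \<partial>?m)"
    by (rule integral_bind_integrable(2)[OF K f ne int'])
  also have "\<dots> = (\<integral>s. (\<integral>a. (\<integral>r. r \<partial>R s ?m a ?n) \<partial>\<pi> t s ?m) \<partial>?m)"
  proof (rule integral_cong_AE)
    show "(\<lambda>s. \<integral>x. ?f x \<partial>?K s) \<in> borel_measurable ?m"
      by (rule measurable_compose[OF K integral_measurable_subprob_algebra[OF f]])
    have g: "(\<lambda>x. \<integral>r. r \<partial>R (fst x) ?m (snd x) ?n) \<in> borel_measurable (borel \<Otimes>\<^sub>M borel)"
      by (rule measurable_compose[OF measurable_prob_algebraD[OF R0]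
            integral_measurable_subprob_algebra]) simp
    \<comment> \<open>Measurability of an integral is known in the measure alone; attaching \<open>s\<close> to the measure
      removes the parameter from the integrand.\<close>
    have "(\<lambda>s. distr (\<pi> t s ?m) (borel \<Otimes>\<^sub>M borel) (Pair s))
        \<in> borel \<rightarrow>\<^sub>M subprob_algebra (borel \<Otimes>\<^sub>M borel)"
      by (rule measurable_distr2[OF _ measurable_prob_algebraD[OF measurable_control[OF asm]]]) simp
    from measurable_compose[OF this integral_measurable_subprob_algebra[OF g]]
    have "(\<lambda>s. \<integral>x. (\<integral>r. r \<partial>R (fst x) ?m (snd x) ?n)
        \<partial>distr (\<pi> t s ?m) (borel \<Otimes>\<^sub>M borel) (Pair s)) \<in> borel_measurable borel" .
    also have "(\<lambda>s. \<integral>x. (\<integral>r. r \<partial>R (fst x) ?m (snd x) ?n)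
        \<partial>distr (\<pi> t s ?m) (borel \<Otimes>\<^sub>M borel) (Pair s)) =
        (\<lambda>s. \<integral>a. (\<integral>r. r \<partial>R s ?m a ?n) \<partial>\<pi> t s ?m)"
      by (subst integral_distr[OF _ g])
         (simp_all add: measurable_cong_sets[OF sets_control[OF asm] refl])
    finally have "(\<lambda>s. \<integral>a. (\<integral>r. r \<partial>R s ?m a ?n) \<partial>\<pi> t s ?m) \<in> borel_measurable borel" .
    then show "(\<lambda>s. \<integral>a. (\<integral>r. r \<partial>R s ?m a ?n) \<partial>\<pi> t s ?m) \<in> borel_measurable ?m"
      by (simp add: measurable_cong_sets[OF m refl])
    show "AE s in ?m. (\<integral>x. ?f x \<partial>?K s) = (\<integral>a. (\<integral>r. r \<partial>R s ?m a ?n) \<partial>\<pi> t s ?m)"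
      using integral_bind_integrable(1)[OF K f ne int']
    proof eventually_elim
      case (elim s)
      then show ?case
        using integral_bind_integrable(2)[OF L f cne, of s] by (simp add: act_kernel_def L_int)
    qed
  qed
  also have "\<dots> = rhat R ?m (\<lambda>s. \<pi> t s ?m)"
    by (simp add: rhat_def action_law_def)
  finally show ?thesis .
qed

text \<open>The deterministic form of the return. Finiteness of the absolute return is what allows the
  expectation to be taken term by term.\<close>

lemma expected_return_sums:
  fixes P :: "('s::{metric_space, second_countable_topology},
      'a::{metric_space, second_countable_topology}, 's) mf_kernel"
    and R :: "('s, 'a, real) mf_kernel"
  assumes ker: "measurable_kernel P" "measurable_kernel R"
    and \<pi>: "\<pi> \<in> controls_from 0" and \<mu>: "\<mu> \<in> prob_measures" and \<gamma>: "0 < \<gamma>"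
    and fin: "expected_abs_return P R \<gamma> \<pi> \<mu> < \<infinity>"
  shows "(\<lambda>t. \<gamma> ^ t * rhat R (state_law P \<pi> \<mu> t) (\<lambda>s. \<pi> t s (state_law P \<pi> \<mu> t)))
    sums expected_return P R \<gamma> \<pi> \<mu>"
proof -
  note asm = ker \<pi> \<mu>
  let ?T = "trajectory_law P R \<pi> \<mu>"
  let ?f = "\<lambda>t \<omega> :: nat \<Rightarrow> 's \<times> 'a \<times> real. \<gamma> ^ t * reward t \<omega>"
  have rew[measurable]: "reward t \<in> borel_measurable ?T" for t
  proof -
    have "(\<lambda>\<omega>. \<omega> t) \<in> ?T \<rightarrow>\<^sub>M step_space"
      unfolding measurable_cong_sets[OF sets_trajectory_law[OF asm] refl]
      by (rule measurable_component_singleton) simp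
    then show ?thesis unfolding reward_def[abs_def] by measurable
  qed
  have norm: "norm (?f t \<omega>) = \<gamma> ^ t * \<bar>reward t \<omega>\<bar>" for t \<omega>
    using \<gamma> by (simp add: abs_mult)
  have fin': "(\<integral>\<^sup>+\<omega>. (\<Sum>t. ennreal (norm (?f t \<omega>))) \<partial>?T) < \<infinity>"
    using fin unfolding expected_abs_return_def norm .
  have sum_fin: "(\<Sum>t. \<integral>\<^sup>+\<omega>. ennreal (norm (?f t \<omega>)) \<partial>?T) < \<infinity>"
    using fin' by (subst (asm) nn_integral_suminf) auto
  have int: "integrable ?T (?f t)" for t
  proof (rule integrableI_bounded)
    have "(\<integral>\<^sup>+\<omega>. ennreal (norm (?f t \<omega>)) \<partial>?T) \<noteq> \<infinity>"
      using sum_fin by (intro ennreal_suminf_lessD[THEN less_imp_neq]) auto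
    then show "(\<integral>\<^sup>+\<omega>. ennreal (norm (?f t \<omega>)) \<partial>?T) < \<infinity>" by (simp add: less_top)
  qed measurable
  have "(\<lambda>t. \<integral>\<omega>. ?f t \<omega> \<partial>?T) sums (\<integral>\<omega>. (\<Sum>t. ?f t \<omega>) \<partial>?T)"
  proof (rule sums_integral[OF int])
    have "AE \<omega> in ?T. (\<Sum>t. ennreal (norm (?f t \<omega>))) \<noteq> \<infinity>"
      using fin' by (intro nn_integral_PInf_AE) auto
    then show "AE \<omega> in ?T. summable (\<lambda>t. norm (?f t \<omega>))"
      by eventually_elim (rule summable_suminf_not_top, auto)
    show "summable (\<lambda>t. \<integral>\<omega>. norm (?f t \<omega>) \<partial>?T)"
    proof (rule summable_suminf_not_top)
      show "(\<Sum>t. ennreal (\<integral>\<omega>. norm (?f t \<omega>) \<partial>?T)) \<noteq> top"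
        using sum_fin by (subst nn_integral_eq_integral[symmetric]) (auto intro: int)
    qed simp
  qed
  moreover have "(\<integral>\<omega>. ?f t \<omega> \<partial>?T) =
      \<gamma> ^ t * rhat R (state_law P \<pi> \<mu> t) (\<lambda>s. \<pi> t s (state_law P \<pi> \<mu> t))" for t
  proof -
    have "integrable ?T (reward t)"
      using int[of t] \<gamma> by simp
    from integral_reward[OF asm this] show ?thesis by simp
  qed
  ultimately show ?thesis unfolding expected_return_def by (simp only:)
qed

section \<open>Shifting controls in time\<close>

lemma state_law_shift:
  "state_law P \<pi> \<mu> (Suc t) = state_law P (\<pi> \<circ> Suc) (Phi P \<mu> (\<lambda>s. \<pi> 0 s \<mu>)) t"
  by (induction t) auto

lemma controls_from_mono: "j \<le> k \<Longrightarrow> controls_from j \<subseteq> controls_from k"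
  by (auto simp: controls_from_def)

lemma controls_from_shift: "\<pi> \<in> controls_from (Suc k) \<Longrightarrow> \<pi> \<circ> Suc \<in> controls_from k"
  by (auto simp: controls_from_def)

lemma controls_from_delay: "\<pi> \<in> controls_from k \<Longrightarrow> case_nat u \<pi> \<in> controls_from (Suc k)"
  by (auto simp: controls_from_def split: nat.split)

lemma first_policy_shift: "first_policy h \<pi> \<circ> Suc = \<pi> \<circ> Suc"
  by (auto simp: first_policy_def)

lemma first_policy_controls_from:
  assumes "h \<in> borel \<rightarrow>\<^sub>M weak_borel" and "\<pi> \<in> controls_from 1"
  shows "first_policy h \<pi> \<in> controls_from 0"
proof -
  have "(\<lambda>(s, \<mu>). h s) \<in> borel \<Otimes>\<^sub>M weak_borel \<rightarrow>\<^sub>M weak_borel"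
    using assms(1) by measurable
  then show ?thesis
    using assms(2) by (auto simp: controls_from_def first_policy_def)
qed

lemma control_slice_measurable:
  assumes "\<pi> \<in> controls_from k" and "k \<le> t" and "\<mu> \<in> prob_measures"
  shows "(\<lambda>s. \<pi> t s \<mu>) \<in> borel \<rightarrow>\<^sub>M weak_borel"
proof -
  have *: "(\<lambda>(s, \<mu>). \<pi> t s \<mu>) \<in> borel \<Otimes>\<^sub>M weak_borel \<rightarrow>\<^sub>M weak_borel"
    using assms by (auto simp: controls_from_def)
  have "(\<lambda>s. (s, \<mu>)) \<in> borel \<rightarrow>\<^sub>M borel \<Otimes>\<^sub>M weak_borel"
    using assms by (auto simp: space_weak_borel)
  from measurable_compose[OF this *] show ?thesis by simp
qed

section \<open>The Bellman equation\<close>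

lemma ereal_SUP_affine:
  fixes c :: ereal
  assumes "I \<noteq> {}" and "0 \<le> x" and "c \<noteq> -\<infinity>"
  shows "(SUP i\<in>I. c + ereal x * f i) = c + ereal x * (SUP i\<in>I. f i)"
  using assms by (simp add: SUP_ereal_add_right Sup_ereal_mult_left')

text \<open>Integrability is stated for initial laws rather than initial random variables; the two forms
  agree over a probability space on which every law is the law of some random variable.\<close>

locale integrable_mfc =
  fixes P :: "('s::{metric_space, second_countable_topology},
      'a::{metric_space, second_countable_topology}, 's) mf_kernel"
    and R :: "('s, 'a, real) mf_kernel" and \<gamma> :: real
  assumes discount_pos: "0 < \<gamma>"
    and kernels: "measurable_kernel P" "measurable_kernel R"
    and abs_return_finite:
      "\<mu> \<in> prob_measures \<Longrightarrow> (SUP \<pi>\<in>controls_from 0. expected_abs_return P R \<gamma> \<pi> \<mu>) < \<infinity>"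
begin

lemma return_sums:
  assumes "\<pi> \<in> controls_from 0" and "\<mu> \<in> prob_measures"
  shows "(\<lambda>t. \<gamma> ^ t * rhat R (state_law P \<pi> \<mu> t) (\<lambda>s. \<pi> t s (state_law P \<pi> \<mu> t)))
    sums expected_return P R \<gamma> \<pi> \<mu>"
  using assms discount_pos kernels
    le_less_trans[OF SUP_upper[OF assms(1)] abs_return_finite[OF assms(2)]]
  by (intro expected_return_sums)

text \<open>A local policy followed by a control is itself a relaxed control, because a local policy
  may ignore the law.\<close>

lemma local_policies_eq: "local_policies P R \<gamma> = borel \<rightarrow>\<^sub>M weak_borel"
proof -
  have "(SUP \<pi>\<in>controls_from 1. expected_abs_return P R \<gamma> (first_policy h \<pi>) \<mu>) < \<infinity>"
    if "h \<in> borel \<rightarrow>\<^sub>M weak_borel" and "\<mu> \<in> prob_measures" for h \<mu>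
  proof (rule le_less_trans[OF _ abs_return_finite[OF that(2)]])
    show "(SUP \<pi>\<in>controls_from 1. expected_abs_return P R \<gamma> (first_policy h \<pi>) \<mu>)
        \<le> (SUP \<pi>\<in>controls_from 0. expected_abs_return P R \<gamma> \<pi> \<mu>)"
      by (intro SUP_least SUP_upper first_policy_controls_from that)
  qed
  then show ?thesis by (auto simp: local_policies_def)
qed

lemma expected_return_step:
  assumes \<pi>: "\<pi> \<in> controls_from 0" and \<mu>: "\<mu> \<in> prob_measures"
  shows "expected_return P R \<gamma> \<pi> \<mu> = rhat R \<mu> (\<lambda>s. \<pi> 0 s \<mu>) +
    \<gamma> * expected_return P R \<gamma> (\<pi> \<circ> Suc) (Phi P \<mu> (\<lambda>s. \<pi> 0 s \<mu>))"
proof -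
  let ?\<mu>' = "Phi P \<mu> (\<lambda>s. \<pi> 0 s \<mu>)" and ?\<sigma> = "\<pi> \<circ> Suc"
  have \<sigma>: "?\<sigma> \<in> controls_from 0"
    using \<pi> controls_from_mono[of 0 1] by (intro controls_from_shift) auto
  have \<mu>': "?\<mu>' \<in> prob_measures"
    using state_law_in_prob_measures[OF kernels \<pi> \<mu>, of 1] by simp
  let ?c = "\<lambda>t. \<gamma> ^ t * rhat R (state_law P \<pi> \<mu> t) (\<lambda>s. \<pi> t s (state_law P \<pi> \<mu> t))"
  have "?c (Suc t) = \<gamma> * (\<gamma> ^ t * rhat R (state_law P ?\<sigma> ?\<mu>' t) (\<lambda>s. ?\<sigma> t s (state_law P ?\<sigma> ?\<mu>' t)))"
    for t
    unfolding state_law_shift by simp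
  then have "(\<lambda>t. ?c (Suc t)) sums (\<gamma> * expected_return P R \<gamma> ?\<sigma> ?\<mu>')"
    by (simp only: sums_mult[OF return_sums[OF \<sigma> \<mu>']])
  from sums_Suc[OF this] have "?c sums (\<gamma> * expected_return P R \<gamma> ?\<sigma> ?\<mu>' + ?c 0)" .
  from sums_unique2[OF return_sums[OF \<pi> \<mu>] this] show ?thesis by simp
qed

lemma IQ_policy_step:
  assumes "h \<in> borel \<rightarrow>\<^sub>M weak_borel" and "\<pi> \<in> controls_from 1" and "\<mu> \<in> prob_measures"
  shows "IQ_policy P R \<gamma> \<pi> \<mu> h =
    rhat R \<mu> h + \<gamma> * expected_return P R \<gamma> (\<pi> \<circ> Suc) (Phi P \<mu> h)"
  using expected_return_step[OF first_policy_controls_from[OF assms(1,2)] assms(3)]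
  by (simp add: IQ_policy_def first_policy_shift) (simp add: first_policy_def)

text \<open>At time 0 the law of the state is the known initial law, so only one section of the first
  control matters.\<close>

lemma expected_return_eq_IQ_policy:
  assumes \<sigma>: "\<sigma> \<in> controls_from 0" and \<mu>: "\<mu> \<in> prob_measures"
  shows "expected_return P R \<gamma> \<sigma> \<mu> = IQ_policy P R \<gamma> \<sigma> \<mu> (\<lambda>s. \<sigma> 0 s \<mu>)"
  using \<sigma> controls_from_mono[of 0 1] \<mu>
  by (subst IQ_policy_step)
     (auto intro: control_slice_measurable[OF \<sigma>] simp: expected_return_step[OF \<sigma> \<mu>])

lemma IQ_Bellman:
  assumes \<mu>: "\<mu> \<in> prob_measures" and h: "h \<in> local_policies P R \<gamma>"
  shows "IQ P R \<gamma> \<mu> h = ereal (rhat R \<mu> h)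
    + ereal \<gamma> * (SUP h'\<in>local_policies P R \<gamma>. IQ P R \<gamma> (Phi P \<mu> h) h')"
proof -
  let ?\<mu>' = "Phi P \<mu> h"
  let ?J = "\<lambda>\<sigma>. ereal (expected_return P R \<gamma> \<sigma> ?\<mu>')"
  have h_meas: "h \<in> borel \<rightarrow>\<^sub>M weak_borel" using h by (simp add: local_policies_eq)
  have ne: "controls_from 1 \<noteq> ({} :: ('s, 'a) control set)"
  proof -
    have "(\<lambda>(s, \<mu>). h s) \<in> borel \<Otimes>\<^sub>M weak_borel \<rightarrow>\<^sub>M weak_borel"
      using h_meas by measurable
    then have "(\<lambda>t s \<mu>. h s) \<in> controls_from 1" unfolding controls_from_def by blast
    then show ?thesis by blast
  qed
  have \<mu>': "?\<mu>' \<in> prob_measures"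
  proof -
    obtain \<pi> :: "('s, 'a) control" where "\<pi> \<in> controls_from 1" using ne by blast
    from state_law_in_prob_measures[OF kernels first_policy_controls_from[OF h_meas this] \<mu>, of 1]
    show ?thesis by (simp add: first_policy_def)
  qed
  have "(SUP \<pi>\<in>controls_from 1. ?J (\<pi> \<circ> Suc)) = (SUP h'\<in>local_policies P R \<gamma>. IQ P R \<gamma> ?\<mu>' h')"
  proof (rule antisym; intro SUP_least)
    fix \<pi> :: "('s, 'a) control" assume "\<pi> \<in> controls_from 1"
    then have \<sigma>: "\<pi> \<circ> Suc \<in> controls_from 0" by (intro controls_from_shift) simp
    let ?h = "\<lambda>s. (\<pi> \<circ> Suc) 0 s ?\<mu>'"
    have "?J (\<pi> \<circ> Suc) \<le> IQ P R \<gamma> ?\<mu>' ?h"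
      unfolding expected_return_eq_IQ_policy[OF \<sigma> \<mu>'] IQ_def
      by (rule SUP_upper) (rule subsetD[OF controls_from_mono \<sigma>], simp)
    also have "\<dots> \<le> (SUP h'\<in>local_policies P R \<gamma>. IQ P R \<gamma> ?\<mu>' h')"
      using control_slice_measurable[OF \<sigma> le0 \<mu>'] by (intro SUP_upper) (simp add: local_policies_eq)
    finally show "?J (\<pi> \<circ> Suc) \<le> (SUP h'\<in>local_policies P R \<gamma>. IQ P R \<gamma> ?\<mu>' h')" .
  next
    fix h' assume h': "h' \<in> local_policies P R \<gamma>"
    show "IQ P R \<gamma> ?\<mu>' h' \<le> (SUP \<pi>\<in>controls_from 1. ?J (\<pi> \<circ> Suc))"
      unfolding IQ_def
    proof (rule SUP_least)
      fix \<pi> :: "('s, 'a) control" assume \<pi>: "\<pi> \<in> controls_from 1"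
      \<comment> \<open>The entry at time 0 is arbitrary: it is overridden by \<open>h\<close>.\<close>
      let ?\<rho> = "case_nat undefined (first_policy h' \<pi>)"
      have "?\<rho> \<in> controls_from 1"
        using controls_from_delay[OF first_policy_controls_from[OF _ \<pi>, of h']] h'
        by (simp add: local_policies_eq)
      moreover have "?\<rho> \<circ> Suc = first_policy h' \<pi>" by auto
      then have "ereal (IQ_policy P R \<gamma> \<pi> ?\<mu>' h') = ?J (?\<rho> \<circ> Suc)" by (simp add: IQ_policy_def)
      ultimately show "ereal (IQ_policy P R \<gamma> \<pi> ?\<mu>' h') \<le> (SUP \<pi>\<in>controls_from 1. ?J (\<pi> \<circ> Suc))"
        by (simp only:) (rule SUP_upper)
    qed
  qed
  moreover have "IQ P R \<gamma> \<mu> h =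
      (SUP \<pi>\<in>controls_from 1. ereal (rhat R \<mu> h) + ereal \<gamma> * ?J (\<pi> \<circ> Suc))"
    unfolding IQ_def by (intro SUP_cong refl) (simp add: IQ_policy_step[OF h_meas _ \<mu>])
  ultimately show ?thesis
    using ereal_SUP_affine[OF ne, of \<gamma> "ereal (rhat R \<mu> h)" "\<lambda>\<pi>. ?J (\<pi> \<circ> Suc)"] discount_pos
    by (simp only: less_imp_le) simp
qed

end

theorem mainTheorem1:
  fixes \<Omega> :: "'w::polish_space measure"
    and P :: "('s::{metric_space, second_countable_topology},
               'a::{metric_space, second_countable_topology}, 's) mf_kernel"
    and R :: "('s, 'a, real) mf_kernel"
    and \<gamma> :: real
  assumes "compact (UNIV :: 's set)" and "compact (UNIV :: 'a set)"
    and "prob_space \<Omega>" and "sets \<Omega> = sets borel" and "atomless \<Omega>"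
    and rich: "\<And>\<mu> :: 's measure. \<mu> \<in> prob_measures \<Longrightarrow>
          \<exists>\<xi>\<in>borel_measurable \<Omega>. distr \<Omega> borel \<xi> = \<mu>"
    and "0 < \<gamma>" and "\<gamma> < 1"
    and "measurable_kernel P" and "measurable_kernel R"
    and integrable: "\<And>\<xi>. \<xi> \<in> borel_measurable \<Omega> \<Longrightarrow>
          (SUP \<pi>\<in>controls_from 0. expected_abs_return P R \<gamma> \<pi> (distr \<Omega> borel \<xi>)) < \<infinity>"
  shows "\<forall>\<mu>\<in>prob_measures. \<forall>h\<in>local_policies P R \<gamma>.
           IQ P R \<gamma> \<mu> h = ereal (rhat R \<mu> h)
             + ereal \<gamma> * (SUP h'\<in>local_policies P R \<gamma>. IQ P R \<gamma> (Phi P \<mu> h) h')"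
proof (intro ballI)
  fix \<mu> :: "'s measure" and h :: "('s, 'a) policy"
  assume \<mu>: "\<mu> \<in> prob_measures" and h: "h \<in> local_policies P R \<gamma>"
  have "(SUP \<pi>\<in>controls_from 0. expected_abs_return P R \<gamma> \<pi> m) < \<infinity>" if m: "m \<in> prob_measures" for m
    using rich[OF m] integrable by blast
  then interpret integrable_mfc P R \<gamma>
    using assms by unfold_locales auto
  show "IQ P R \<gamma> \<mu> h = ereal (rhat R \<mu> h)
      + ereal \<gamma> * (SUP h'\<in>local_policies P R \<gamma>. IQ P R \<gamma> (Phi P \<mu> h) h')"
    by (rule IQ_Bellman[OF \<mu> h])
qed

end
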